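(* In the setting described in the context, let $u_1=Ue_1$ be the first column of $U$ and assume that $\mathrm{Re}(u_1)$ and $\mathrm{Im}(u_1)$ are linearly independent (over $\mathbb{R}$). Let $w=S_2Ve_1/\sigma_1$, and let $c,s$ be the Jacobi rotation parameters associated with $z=u_1$. Define real vectors by $$\begin{bmatrix}x_{j+1}&x_{j+2}\end{bmatrix}=\begin{bmatrix}\mathrm{Re}(u_1)&\mathrm{Im}(u_1)\end{bmatrix}\begin{bmatrix}c&s\\ -s&c\end{bmatrix},\qquad \begin{bmatrix}v_{j+1}&v_{j+2}\end{bmatrix}=\begin{bmatrix}\mathrm{Re}(w)&\mathrm{Im}(w)\end{bmatrix}\begin{bmatrix}c&s\\ -s&c\end{bmatrix}.$$ Then $x_{j+1},x_{j+2},v_{j+1},v_{j+2}$ satisfy the constraints $$Q_2^\top\left(A\begin{bmatrix}x_{j+1}&x_{j+2}\end{bmatrix}-X_j\begin{bmatrix}v_{j+1}&v_{j+2}\end{bmatrix}-\begin{bmatrix}x_{j+1}&x_{j+2}\end{bmatrix}D_0\right)=0,$$ $$X_j^\top\begin{bmatrix}x_{j+1}&x_{j+2}\end{bmatrix}=0,\qquad \begin{bmatrix}x_{j+1}&x_{j+2}\end{bmatrix}^\top\begin{bmatrix}x_{j+1}&x_{j+2}\end{bmatrix}=\begin{bmatrix}1/\delta_1^2&0\\ 0&1/\delta_2^2\end{bmatrix}$$ with $\delta_1=1/\|x_{j+1}\|_2$ and $\delta_2=1/\|x_{j+2}\|_2$, and the corresponding value of the objective function satisfies $$\|\delta_1v_{j+1}\|_2^2+\|\delta_2v_{j+2}\|_2^2+\beta_{j+1}^2\left(\frac{\delta_1}{\delta_2}-\frac{\delta_2}{\delta_1}\right)^2\le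 \frac{1}{\min\{\|x_{j+1}\|_2^2,\|x_{j+2}\|_2^2\}}\left(\frac{1-\sigma_1^2}{\sigma_1^2}+\beta_{j+1}^2\right).$$
   Context: Setting. $A\in\mathbb{R}^{n\times n}$, $B\in\mathbb{R}^{n\times m}$ has full column rank, and $(A,B)$ is controllable, i.e. $\begin{bmatrix}B&AB&\cdots&A^{n-1}B\end{bmatrix}$ has full row rank. Let $B=Q\begin{bmatrix}R\\ 0\end{bmatrix}$ be a QR decomposition with $Q=\begin{bmatrix}Q_1&Q_2\end{bmatrix}\in\mathbb{R}^{n\times n}$ orthogonal, $Q_1\in\mathbb{R}^{n\times m}$, $Q_2\in\mathbb{R}^{n\times(n-m)}$, and $R\in\mathbb{R}^{m\times m}$ nonsingular upper triangular. Let $1\le j\le n-2$, and let $X_j\in\mathbb{R}^{n\times j}$ and an upper quasi-triangular $T_j\in\mathbb{R}^{j\times j}$ (diagonal blocks of size $1\times1$ or $2\times2$) satisfy $Q_2^\top(AX_j-X_jT_j)=0$ and $X_j^\top X_j=I_j$. Let $\lambda_{j+1}=\alpha_{j+1}+i\beta_{j+1}$ with $\alpha_{j+1},\beta_{j+1}\in\mathbb{R}$, $\beta_{j+1}\neq0$, and set $$D_0=\begin{bmatrix}\alpha_{j+1}&\beta_{j+1}\\ -\beta_{j+1}&\alpha_{j+1}\end{bmatrix},\qquad M_{j+1}=\begin{bmatrix}Q_2^\top(A-(\alpha_{j+1}+i\beta_{j+1})I_n)&-Q_2^\top X_j\\ {X_j^\top}&0\end{bmatrix}.$$ Let $r$ be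 the dimension of the null space of $M_{j+1}$ in $\mathbb{C}^{n+j}$, and let the columns of $S=\begin{bmatrix}S_1\\ S_2\end{bmatrix}\in\mathbb{C}^{(n+j)\times r}$, with $S_1\in\mathbb{C}^{n\times r}$, $S_2\in\mathbb{C}^{j\times r}$, form an orthonormal basis of this null space. Let $S_1=U\Sigma V^*$ be a singular value decomposition ($U$, $V$ unitary, singular values in decreasing order), let $\sigma_1>0$ be the largest singular value of $S_1$, and let $e_1$ denote the first column of the identity matrix. Jacobi rotation parameters. For $z\in\mathbb{C}^n$ put $\varrho_1=\|\mathrm{Re}(z)\|_2^2$, $\varrho_2=\|\mathrm{Im}(z)\|_2^2$, $\gamma=\mathrm{Re}(z)^\top\mathrm{Im}(z)$. If $\gamma\ne0$, let $\tau=\frac{\varrho_2-\varrho_1}{2\gamma}$ and $t=1/(\tau+\sqrt{1+\tau^2})$ if $\tau\ge0$, $t=-1/(-\tau+\sqrt{1+\tau^2})$ if $\tau<0$; if $\gamma=0$, let $t=0$. Then $c=1/\sqrt{1+t^2}$ and $s=tc$. *)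

theory Defs
  imports
    "Jordan_Normal_Form.Schur_Decomposition"
    "Jordan_Normal_Form.Matrix_Kernel"
    "Jordan_Normal_Form.DL_Rank"
begin

abbreviation cmat :: "real mat \<Rightarrow> complex mat"
  where "cmat \<equiv> map_mat complex_of_real"

abbreviation Re_vec :: "complex vec \<Rightarrow> real vec"
  where "Re_vec \<equiv> map_vec Re"

abbreviation Im_vec :: "complex vec \<Rightarrow> real vec"
  where "Im_vec \<equiv> map_vec Im"

definition norm2 :: "real vec \<Rightarrow> real"
  where "norm2 x = sqrt (x \<bullet> x)"

text \<open>Square matrices only. The library's \<open>orthogonal_mat\<close> merely asks for pairwise orthogonal
  nonzero columns, without normalization.\<close>

definition orthogonal_matrix :: "nat \<Rightarrow> real mat \<Rightarrow> bool"
  where "orthogonal_matrix n Q \<longleftrightarrow>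
    Q \<in> carrier_mat n n \<and> transpose_mat Q * Q = 1\<^sub>m n \<and> Q * transpose_mat Q = 1\<^sub>m n"

definition unitary_matrix :: "nat \<Rightarrow> complex mat \<Rightarrow> bool"
  where "unitary_matrix n U \<longleftrightarrow>
    U \<in> carrier_mat n n \<and> mat_adjoint U * U = 1\<^sub>m n \<and> U * mat_adjoint U = 1\<^sub>m n"

definition append_cols :: "'a :: zero mat \<Rightarrow> 'a mat \<Rightarrow> 'a mat"  (infixr "@\<^sub>c" 65)
  where "P @\<^sub>c Q = four_block_mat P Q (0\<^sub>m 0 (dim_col P)) (0\<^sub>m 0 (dim_col Q))"

text \<open>The controllability matrix \<open>[B, A B, ..., A^(n-1) B]\<close>: column \<open>k\<close> lies in block \<open>k div m\<close>.\<close>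

definition controllability_matrix :: "nat \<Rightarrow> nat \<Rightarrow> real mat \<Rightarrow> real mat \<Rightarrow> real mat"
  where "controllability_matrix n m A B =
    mat n (n * m) (\<lambda>(i, k). ((A ^\<^sub>m (k div m)) * B) $$ (i, k mod m))"

definition controllable :: "nat \<Rightarrow> nat \<Rightarrow> real mat \<Rightarrow> real mat \<Rightarrow> bool"
  where "controllable n m A B \<longleftrightarrow> vec_space.rank n (controllability_matrix n m A B) = n"

text \<open>The list \<open>bs\<close> contains the sizes of the diagonal blocks, so that block \<open>p\<close> starts at
  row and column \<open>sum_list (take p bs)\<close>; everything to the left of each diagonal block and
  in or below its rows vanishes.\<close>

definition upper_quasi_triangular :: "nat \<Rightarrow> real mat \<Rightarrow> bool"
  where "upper_quasi_triangular j T \<longleftrightarrow> T \<in> carrier_mat j j \<and>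
    (\<exists>bs. set bs \<subseteq> {1, 2} \<and> sum_list bs = j \<and>
      (\<forall>p < length bs. \<forall>i k.
        sum_list (take p bs) \<le> i \<and> i < j \<and> k < sum_list (take p bs) \<longrightarrow> T $$ (i, k) = 0))"

definition orthonormal_basis_of_kernel :: "complex mat \<Rightarrow> nat \<Rightarrow> complex mat \<Rightarrow> bool"
  where "orthonormal_basis_of_kernel M r S \<longleftrightarrow>
    S \<in> carrier_mat (dim_col M) r \<and> mat_adjoint S * S = 1\<^sub>m r \<and>
    kernel.basis (dim_col M) M (set (cols S))"

text \<open>Full singular value decomposition of an \<open>n\<close> by \<open>r\<close> matrix; \<open>Sig\<close> is rectangular.\<close>

definition is_svd :: "nat \<Rightarrow> nat \<Rightarrow> complex mat \<Rightarrow> complex mat \<Rightarrow> real mat \<Rightarrow> complex mat \<Rightarrow> bool"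
  where "is_svd n r S U Sig V \<longleftrightarrow>
    unitary_matrix n U \<and> unitary_matrix r V \<and> Sig \<in> carrier_mat n r \<and> diagonal_mat Sig \<and>
    (\<forall>i < min n r. 0 \<le> Sig $$ (i, i)) \<and>
    (\<forall>i k. i \<le> k \<and> k < min n r \<longrightarrow> Sig $$ (k, k) \<le> Sig $$ (i, i)) \<and>
    S = U * cmat Sig * mat_adjoint V"

text \<open>Stated for the family \<open>(x, y)\<close>, not for the set \<open>{x, y}\<close>, which would be independent
  whenever \<open>x = y \<noteq> 0\<close>.\<close>

definition lin_indpt_pair :: "nat \<Rightarrow> real vec \<Rightarrow> real vec \<Rightarrow> bool"
  where "lin_indpt_pair n x y \<longleftrightarrow>
    (\<forall>a b :: real. a \<cdot>\<^sub>v x + b \<cdot>\<^sub>v y = 0\<^sub>v n \<longrightarrow> a = 0 \<and> b = 0)"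

definition D0_mat :: "real \<Rightarrow> real \<Rightarrow> real mat"
  where "D0_mat \<alpha> \<beta> = mat_of_rows_list 2 [[\<alpha>, \<beta>], [- \<beta>, \<alpha>]]"

definition M_mat :: "real mat \<Rightarrow> real mat \<Rightarrow> real mat \<Rightarrow> complex \<Rightarrow> complex mat"
  where "M_mat A Q2 X l = four_block_mat
    (transpose_mat (cmat Q2) * (cmat A - l \<cdot>\<^sub>m 1\<^sub>m (dim_row A)))
    (- (transpose_mat (cmat Q2) * cmat X))
    (transpose_mat (cmat X))
    (0\<^sub>m (dim_col X) (dim_col X))"

definition jacobi_t :: "complex vec \<Rightarrow> real"
  where "jacobi_t z =
    (let \<rho>1 = (norm2 (Re_vec z))\<^sup>2;
         \<rho>2 = (norm2 (Im_vec z))\<^sup>2;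
         \<gamma> = Re_vec z \<bullet> Im_vec z;
         \<tau> = (\<rho>2 - \<rho>1) / (2 * \<gamma>)
     in if \<gamma> = 0 then 0
        else if \<tau> \<ge> 0 then 1 / (\<tau> + sqrt (1 + \<tau>\<^sup>2))
        else - 1 / (- \<tau> + sqrt (1 + \<tau>\<^sup>2)))"

definition jacobi_c :: "complex vec \<Rightarrow> real"
  where "jacobi_c z = 1 / sqrt (1 + (jacobi_t z)\<^sup>2)"

definition jacobi_s :: "complex vec \<Rightarrow> real"
  where "jacobi_s z = jacobi_t z * jacobi_c z"

end

theory Submission
  imports Defs
begin

text \<open>The SVD gives \<open>S V e\<^sub>1 = \<sigma>\<^sub>1 (u\<^sub>1, w)\<close>. So \<open>(u\<^sub>1, w)\<close> lies in the kernel of \<open>M\<close>,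
  whose real and imaginary parts are the two linear constraints before rotation; they survive the
  rotation because it commutes with \<open>D\<^sub>0\<close>. As \<open>S\<close> is an isometry and \<open>u\<^sub>1\<close> a unit vector,
  \<open>\<parallel>w\<parallel>\<^sup>2 = (1 - \<sigma>\<^sub>1\<^sup>2) / \<sigma>\<^sub>1\<^sup>2\<close>. The rotation preserves the sums of squared norms, so with
  \<open>p = \<parallel>x\<^sub>1\<parallel>\<^sup>2\<close> and \<open>q = \<parallel>x\<^sub>2\<parallel>\<^sup>2\<close>, where \<open>p + q = 1\<close>, the bound reduces to
  \<open>(p - q)\<^sup>2 / (p q) \<le> 1 / min p q\<close>.\<close>

section \<open>Adjoints and isometries over the complex numbers\<close>

text \<open>Both sides are the same double sum over the entries of \<open>A\<close>, taken in the
  two orders.\<close>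

lemma cscalar_prod_mult_mat_vec:
  fixes A :: "complex mat"
  assumes A: "A \<in> carrier_mat nr nc" and x: "x \<in> carrier_vec nc" and y: "y \<in> carrier_vec nr"
  shows "(A *\<^sub>v x) \<bullet>c y = x \<bullet>c (mat_adjoint A *\<^sub>v y)"
proof -
  have "(A *\<^sub>v x) \<bullet>c y = (\<Sum>i<nr. \<Sum>k<nc. A $$ (i,k) * x $ k * conjugate (y $ i))"
    using A x y by (simp add: scalar_prod_def sum_distrib_right lessThan_atLeast0)
  also have "\<dots> = (\<Sum>k<nc. \<Sum>i<nr. A $$ (i,k) * x $ k * conjugate (y $ i))"
    by (rule sum.swap)
  also have "\<dots> = (\<Sum>k<nc. x $ k * conjugate ((mat_adjoint A *\<^sub>v y) $ k))"
  proof (rule sum.cong[OF refl])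
    fix k assume "k \<in> {..<nc}"
    then have "(mat_adjoint A *\<^sub>v y) $ k = (\<Sum>i<nr. cnj (A $$ (i,k)) * y $ i)"
      using A y
      by (simp add: mat_adjoint_def mat_of_rows_def scalar_prod_def lessThan_atLeast0)
    then show "(\<Sum>i<nr. A $$ (i,k) * x $ k * conjugate (y $ i)) =
        x $ k * conjugate ((mat_adjoint A *\<^sub>v y) $ k)"
      by (simp add: sum_distrib_left mult.assoc mult.left_commute)
  qed
  also have "\<dots> = x \<bullet>c (mat_adjoint A *\<^sub>v y)"
    using A x by (simp add: scalar_prod_def mat_adjoint_def lessThan_atLeast0)
  finally show ?thesis .
qed

text \<open>Moving \<open>A\<close> across the inner product produces
  \<open>mat_adjoint A * A\<close>. The rectangular form serves both the unitary factors of the SVD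
  and the kernel basis \<open>S\<close>.\<close>

lemma cscalar_prod_isometry:
  fixes A :: "complex mat"
  assumes A: "A \<in> carrier_mat nr nc" and orth: "mat_adjoint A * A = 1\<^sub>m nc"
    and x: "x \<in> carrier_vec nc"
  shows "(A *\<^sub>v x) \<bullet>c (A *\<^sub>v x) = x \<bullet>c x"
proof -
  have A': "mat_adjoint A \<in> carrier_mat nc nr"
    using A by (auto simp: mat_adjoint_def)
  have "(A *\<^sub>v x) \<bullet>c (A *\<^sub>v x) = x \<bullet>c (mat_adjoint A *\<^sub>v (A *\<^sub>v x))"
    using A x by (intro cscalar_prod_mult_mat_vec) auto
  also have "mat_adjoint A *\<^sub>v (A *\<^sub>v x) = x"
    using assoc_mult_mat_vec[OF A' A x] orth x by simp
  finally show ?thesis .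
qed

section \<open>Norms, and passage from complex to real vectors\<close>

lemma norm2_square: "(norm2 x)\<^sup>2 = x \<bullet> x"
  by (simp add: norm2_def scalar_prod_def sum_nonneg)

lemma norm2_smult: "(norm2 (k \<cdot>\<^sub>v x))\<^sup>2 = k\<^sup>2 * (norm2 x)\<^sup>2"
  unfolding norm2_square by (simp add: scalar_prod_def sum_distrib_left power2_eq_square mult_ac)

text \<open>Turns complex lengths, such as that of the unit vector \<open>u1\<close>, into
  statements about the real pairs that are rotated.\<close>

lemma cscalar_prod_self_Re_Im:
  "z \<bullet>c z = complex_of_real (Re_vec z \<bullet> Re_vec z + Im_vec z \<bullet> Im_vec z)"
  by (rule complex_eqI) (simp_all add: scalar_prod_def sum.distrib)

text \<open>A real matrix acts on real and imaginary parts separately. With its counterpart for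
  \<open>Im_vec\<close>, this splits a complex kernel equation into two real ones.\<close>

lemma map_vec_Re_mult:
  assumes "K \<in> carrier_mat nr nc" "z \<in> carrier_vec nc"
  shows "Re_vec (cmat K *\<^sub>v z) = K *\<^sub>v Re_vec z"
  using assms by (intro eq_vecI) (auto simp: scalar_prod_def)

lemma map_vec_Im_mult:
  assumes "K \<in> carrier_mat nr nc" "z \<in> carrier_vec nc"
  shows "Im_vec (cmat K *\<^sub>v z) = K *\<^sub>v Im_vec z"
  using assms by (intro eq_vecI) (auto simp: scalar_prod_def)

section \<open>Matrices with two columns\<close>

lemma mult_mat_of_cols_pair:
  assumes "K \<in> carrier_mat k n" "a \<in> carrier_vec n" "b \<in> carrier_vec n"
  shows "K * mat_of_cols n [a, b] = mat_of_cols k [K *\<^sub>v a, K *\<^sub>v b]"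
  using assms by (intro eq_matI) (auto simp: mat_of_cols_index less_Suc_eq numeral_2_eq_2)

lemma minus_mat_of_cols_pair:
  fixes a b a' b' :: "'a :: ab_group_add vec"
  assumes "a \<in> carrier_vec n" "b \<in> carrier_vec n" "a' \<in> carrier_vec n" "b' \<in> carrier_vec n"
  shows "mat_of_cols n [a, b] - mat_of_cols n [a', b'] = mat_of_cols n [a - a', b - b']"
  using assms by (intro eq_matI) (auto simp: mat_of_cols_index less_Suc_eq numeral_2_eq_2)

lemma mat_of_cols_pair_mult:
  fixes a b :: "'a :: comm_ring_1 vec"
  assumes "a \<in> carrier_vec n" "b \<in> carrier_vec n"
  shows "mat_of_cols n [a, b] * mat_of_rows_list 2 [[p, q], [p', q']] =
    mat_of_cols n [p \<cdot>\<^sub>v a + p' \<cdot>\<^sub>v b, q \<cdot>\<^sub>v a + q' \<cdot>\<^sub>v b]"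
  using assms
  by (intro eq_matI)
    (auto simp: mat_of_cols_index mat_of_rows_list_def less_Suc_eq numeral_2_eq_2 scalar_prod_def
      mult.commute)

lemma mat_of_cols_pair_inj:
  assumes "mat_of_cols n [a, b] = mat_of_cols n [a', b']"
    and "a \<in> carrier_vec n" "b \<in> carrier_vec n" "a' \<in> carrier_vec n" "b' \<in> carrier_vec n"
  shows "a = a' \<and> b = b'"
proof -
  have "cols (mat_of_cols n [a, b]) = cols (mat_of_cols n [a', b'])"
    using assms(1) by simp
  then show ?thesis
    using assms(2-) by simp
qed

lemma gram_mat_of_cols_pair:
  fixes a b :: "'a :: comm_ring_1 vec"
  assumes "a \<in> carrier_vec n" "b \<in> carrier_vec n"
  shows "transpose_mat (mat_of_cols n [a, b]) * mat_of_cols n [a, b] =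
    mat_of_rows_list 2 [[a \<bullet> a, a \<bullet> b], [a \<bullet> b, b \<bullet> b]]"
  using assms comm_scalar_prod[of a n b]
  by (intro eq_matI) (auto simp: mat_of_rows_list_def less_Suc_eq numeral_2_eq_2)

section \<open>Rotated pairs and the Jacobi parameters\<close>

lemma scalar_prod_lin_comb2:
  fixes a b :: "real vec"
  assumes "a \<in> carrier_vec n" "b \<in> carrier_vec n"
  shows "(p \<cdot>\<^sub>v a + q \<cdot>\<^sub>v b) \<bullet> (p' \<cdot>\<^sub>v a + q' \<cdot>\<^sub>v b) =
    p * p' * (a \<bullet> a) + (p * q' + q * p') * (a \<bullet> b) + q * q' * (b \<bullet> b)"
  using assms comm_scalar_prod[of a n b]
  by (simp add: add_scalar_prod_distrib[of _ n] scalar_prod_add_distrib[of _ n] algebra_simps)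

text \<open>The quadratic \<open>t\<^sup>2 + 2 \<tau> t = 1\<close> multiplied by \<open>\<gamma>\<close>, so that it also covers \<open>\<gamma> = 0\<close>.\<close>

lemma jacobi_t_root:
  "(jacobi_t z)\<^sup>2 * (Re_vec z \<bullet> Im_vec z)
    + jacobi_t z * ((norm2 (Im_vec z))\<^sup>2 - (norm2 (Re_vec z))\<^sup>2) = Re_vec z \<bullet> Im_vec z"
proof (cases "Re_vec z \<bullet> Im_vec z = 0")
  case True
  then show ?thesis by (simp add: jacobi_t_def)
next
  case False
  define g where "g = Re_vec z \<bullet> Im_vec z"
  define \<tau> where "\<tau> = ((norm2 (Im_vec z))\<^sup>2 - (norm2 (Re_vec z))\<^sup>2) / (2 * g)"
  have g: "g \<noteq> 0" using False by (simp add: g_def)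
  define R where "R = sqrt (1 + \<tau>\<^sup>2)"
  have R2: "R\<^sup>2 = 1 + \<tau>\<^sup>2" by (simp add: R_def)
  have R: "\<bar>\<tau>\<bar> < R"
    unfolding R_def by (rule real_less_rsqrt) simp
  have "jacobi_t z = (if \<tau> \<ge> 0 then 1 / (\<tau> + R) else - 1 / (- \<tau> + R))"
    using g by (simp add: jacobi_t_def Let_def g_def \<tau>_def R_def)
  \<comment> \<open>Rationalising with \<open>R\<^sup>2 - \<tau>\<^sup>2 = 1\<close> exhibits both
    branches as roots of the quadratic; \<bar>\<tau>\<bar> < \<open>R\<close> keeps the denominators
    nonzero.\<close>
  moreover have "1 / (\<tau> + R) = R - \<tau>" "- 1 / (- \<tau> + R) = - \<tau> - R"
    using R R2 by (simp_all add: field_simps power2_eq_square)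
  ultimately have "jacobi_t z = R - \<tau> \<or> jacobi_t z = - \<tau> - R" by presburger
  then have "(jacobi_t z + \<tau>)\<^sup>2 = R\<^sup>2"
    by (auto simp: power2_eq_iff)
  then have t: "(jacobi_t z)\<^sup>2 + 2 * \<tau> * jacobi_t z = 1"
    unfolding R2 by (simp add: power2_eq_square algebra_simps)
  have d: "(norm2 (Im_vec z))\<^sup>2 - (norm2 (Re_vec z))\<^sup>2 = 2 * \<tau> * g"
    using g by (simp add: \<tau>_def)
  have "((jacobi_t z)\<^sup>2 + 2 * \<tau> * jacobi_t z) * g = g" unfolding t by simp
  then show ?thesis
    unfolding d g_def[symmetric] by (simp add: algebra_simps)
qed

lemma jacobi_norm: "(jacobi_c z)\<^sup>2 + (jacobi_s z)\<^sup>2 = 1"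
proof -
  have "1 + (jacobi_t z)\<^sup>2 > 0" by (simp add: add_pos_nonneg)
  then show ?thesis
    by (simp add: jacobi_s_def jacobi_c_def power_mult_distrib power_divide field_simps)
qed

text \<open>The left side is the expanded inner product of the two rotated vectors. Since
  \<open>s = t * c\<close>, it equals \<open>c\<^sup>2\<close> times the difference of the two sides
  of the equation for \<open>t\<close>.\<close>

lemma jacobi_orthogonal:
  "jacobi_c z * jacobi_s z * (Re_vec z \<bullet> Re_vec z)
    + ((jacobi_c z)\<^sup>2 - (jacobi_s z)\<^sup>2) * (Re_vec z \<bullet> Im_vec z)
    - jacobi_s z * jacobi_c z * (Im_vec z \<bullet> Im_vec z) = 0"
proof -
  have "(jacobi_c z)\<^sup>2 * (Re_vec z \<bullet> Im_vec z - ((jacobi_t z)\<^sup>2 * (Re_vec z \<bullet> Im_vec z)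
      + jacobi_t z * (Im_vec z \<bullet> Im_vec z - Re_vec z \<bullet> Re_vec z))) = 0"
    using jacobi_t_root[of z] by (simp add: norm2_square)
  then show ?thesis
    by (simp add: jacobi_s_def power2_eq_square algebra_simps)
qed

section \<open>Kernels and their orthonormal bases\<close>

lemma wide_mat_kernel_nontrivial:
  fixes M :: "'a :: field mat"
  assumes M: "M \<in> carrier_mat nr nc" and less: "nr < nc"
  obtains v where "v \<in> mat_kernel M" "v \<noteq> 0\<^sub>v nc"
proof -
  \<comment> \<open>Padding \<open>M\<close> with zero rows makes it square and singular.\<close>
  define N where "N = M @\<^sub>r 0\<^sub>m (nc - nr) nc"
  have N: "N \<in> carrier_mat nc nc"
    using carrier_append_rows[OF M zero_carrier_mat, of "nc - nr"] less by (simp add: N_def)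
  have "row N (nc - 1) = 0\<^sub>v nc"
    using M less by (intro eq_vecI) (auto simp: N_def append_rows_def)
  then have "N $$ (nc - 1, k) = 0" if "k < nc" for k
    using N less that index_row(1)[of "nc - 1" N k] by simp
  then have "N = mat\<^sub>r nc nc (\<lambda>i. if i = nc - 1 then 0\<^sub>v nc else row N i)"
    using N by (intro eq_matI) auto
  also have "det \<dots> = 0"
    using less N by (intro det_row_0) auto
  finally have "det N = 0" .
  then obtain v where v: "v \<in> carrier_vec nc" "v \<noteq> 0\<^sub>v nc" and "N *\<^sub>v v = 0\<^sub>v nc"
    using det_0_iff_vec_prod_zero_field[OF N] by auto
  \<comment> \<open>Undoing the padding: the first \<open>nr\<close> entries of
    \<open>N *\<^sub>v v\<close> are those of \<open>M *\<^sub>v v\<close>.\<close>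
  then have "(M *\<^sub>v v) @\<^sub>v (0\<^sub>m (nc - nr) nc *\<^sub>v v) = 0\<^sub>v nc"
    using mat_mult_append[OF M _ v(1), of "0\<^sub>m (nc - nr) nc" "nc - nr"] by (simp add: N_def)
  also have "\<dots> = 0\<^sub>v nr @\<^sub>v 0\<^sub>v (nc - nr)"
    using less by (intro eq_vecI) auto
  finally have "M *\<^sub>v v = 0\<^sub>v nr"
    using M by (subst (asm) append_vec_eq[of _ nr]) (auto simp: mult_mat_vec_carrier[OF M v(1)])
  then show thesis
    using that mat_kernelI[OF M v(1)] v(2) by blast
qed

lemma orthonormal_basis_of_kernel_subset:
  assumes "orthonormal_basis_of_kernel M r S"
  shows "set (cols S) \<subseteq> mat_kernel M"
proof -
  interpret kernel "dim_row M" "dim_col M" M by unfold_locales auto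
  show ?thesis
    using assms by (simp add: orthonormal_basis_of_kernel_def Ker.basis_def)
qed

lemma orthonormal_basis_of_kernel_mult:
  assumes S: "orthonormal_basis_of_kernel M r S" and p: "p \<in> carrier_vec r"
  shows "M *\<^sub>v (S *\<^sub>v p) = 0\<^sub>v (dim_row M)"
proof -
  have SC: "S \<in> carrier_mat (dim_col M) r"
    using S by (simp add: orthonormal_basis_of_kernel_def)
  have "M * S = 0\<^sub>m (dim_row M) r"
  proof (rule mat_col_eqI)
    fix i assume "i < dim_col (0\<^sub>m (dim_row M) r)"
    then have i: "i < r" by simp
    then have "col S i \<in> mat_kernel M"
      using orthonormal_basis_of_kernel_subset[OF S] SC by (auto simp: cols_def)
    then show "col (M * S) i = col (0\<^sub>m (dim_row M) r) i"
      using i SC col_mult2[of M "dim_row M" "dim_col M" S r i] by (simp add: mat_kernel_def)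
  qed (use SC in auto)
  moreover have "M * S *\<^sub>v p = M *\<^sub>v (S *\<^sub>v p)"
    using SC p by (intro assoc_mult_mat_vec) auto
  moreover have "0\<^sub>m (dim_row M) r *\<^sub>v p = 0\<^sub>v (dim_row M)"
    using p by (intro eq_vecI) auto
  ultimately show ?thesis by simp
qed

text \<open>For \<open>r = 0\<close> the empty basis would span only the zero vector, but a matrix
  with more columns than rows kills a nonzero vector.\<close>

lemma orthonormal_basis_of_kernel_wide:
  assumes S: "orthonormal_basis_of_kernel M r S" and wide: "dim_row M < dim_col M"
  shows "r > 0"
proof (rule ccontr)
  interpret kernel "dim_row M" "dim_col M" M by unfold_locales auto
  assume "\<not> r > 0"
  then have "set (cols S) = {}"
    using S by (auto simp: orthonormal_basis_of_kernel_def cols_def)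
  then have "span {} = mat_kernel M"
    using S by (simp add: orthonormal_basis_of_kernel_def Ker.basis_def)
  moreover have "span {} = {0\<^sub>v (dim_col M)}"
    by (simp add: Ker.span_empty)
  ultimately show False
    using wide_mat_kernel_nontrivial[OF A wide] by auto
qed

section \<open>Singular vectors\<close>

lemma unitary_matrix_unit_vec:
  assumes "unitary_matrix n U" "k < n"
  shows "(U *\<^sub>v unit_vec n k) \<bullet>c (U *\<^sub>v unit_vec n k) = 1"
proof -
  have "unit_vec n k \<bullet>c unit_vec n k = (1::complex)"
    using assms(2) by (simp add: scalar_prod_left_unit)
  then show ?thesis
    using assms cscalar_prod_isometry[of U n n "unit_vec n k"]
    by (simp add: unitary_matrix_def)
qed

text \<open>\<open>V\<close> cancels against its adjoint, and the rectangular diagonal factor sends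
  the \<open>k\<close>-th unit vector of length \<open>r\<close> to a multiple of the one of length
  \<open>n\<close>; hence both bounds on \<open>k\<close>.\<close>

lemma is_svd_singular_vector:
  assumes svd: "is_svd n r S U Sig V" and k: "k < n" "k < r"
  shows "S *\<^sub>v (V *\<^sub>v unit_vec r k) = complex_of_real (Sig $$ (k, k)) \<cdot>\<^sub>v (U *\<^sub>v unit_vec n k)"
proof -
  have U: "U \<in> carrier_mat n n" and V: "V \<in> carrier_mat r r"
    and VV: "mat_adjoint V * V = 1\<^sub>m r" and Sig: "Sig \<in> carrier_mat n r"
    and diag: "diagonal_mat Sig" and S: "S = U * cmat Sig * mat_adjoint V"
    using svd by (auto simp: is_svd_def unitary_matrix_def)
  have V': "mat_adjoint V \<in> carrier_mat r r"
    using V by (auto simp: mat_adjoint_def)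
  have US: "U * cmat Sig \<in> carrier_mat n r" using U Sig by simp
  have e: "unit_vec r k \<in> carrier_vec r" by simp
  have "S *\<^sub>v (V *\<^sub>v unit_vec r k) = U * cmat Sig *\<^sub>v (mat_adjoint V *\<^sub>v (V *\<^sub>v unit_vec r k))"
    unfolding S using assoc_mult_mat_vec[OF US V'] V by simp
  also have "mat_adjoint V *\<^sub>v (V *\<^sub>v unit_vec r k) = unit_vec r k"
    using assoc_mult_mat_vec[OF V' V e] VV by simp
  also have "U * cmat Sig *\<^sub>v unit_vec r k = U *\<^sub>v (cmat Sig *\<^sub>v unit_vec r k)"
    using U Sig by (intro assoc_mult_mat_vec) auto
  also have "cmat Sig *\<^sub>v unit_vec r k = complex_of_real (Sig $$ (k, k)) \<cdot>\<^sub>v unit_vec n k"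
    using Sig diag k by (intro eq_vecI) (auto simp: diagonal_mat_def scalar_prod_right_unit)
  also have "U *\<^sub>v \<dots> = complex_of_real (Sig $$ (k, k)) \<cdot>\<^sub>v (U *\<^sub>v unit_vec n k)"
    using U by (intro mult_mat_vec) auto
  finally show ?thesis .
qed

section \<open>Block equations for the kernel of \<open>M_mat\<close>\<close>

lemma smult_zero_vec: "k \<cdot>\<^sub>v 0\<^sub>v n = (0\<^sub>v n :: 'a :: mult_zero vec)"
  by (intro eq_vecI) auto

lemma zero_vec_append: "0\<^sub>v (q + j) = 0\<^sub>v q @\<^sub>v 0\<^sub>v j"
  by (intro eq_vecI) auto

text \<open>These are the two block rows of the kernel equation. In the first one the transpose of
  \<open>Q2\<close> is factored out, leaving a single complex residual vector whose real and
  imaginary parts can be taken.\<close>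

lemma M_mat_kernel:
  assumes A: "A \<in> carrier_mat n n" and Q2: "Q2 \<in> carrier_mat n q" and X: "X \<in> carrier_mat n j"
    and u: "u \<in> carrier_vec n" and w: "w \<in> carrier_vec j"
    and ker: "M_mat A Q2 X l *\<^sub>v (u @\<^sub>v w) = 0\<^sub>v (q + j)"
  shows "cmat (transpose_mat Q2) *\<^sub>v (cmat A *\<^sub>v u - cmat X *\<^sub>v w - l \<cdot>\<^sub>v u) = 0\<^sub>v q"
    and "cmat (transpose_mat X) *\<^sub>v u = 0\<^sub>v j"
proof -
  let ?P = "transpose_mat (cmat Q2)"
  have P: "?P \<in> carrier_mat q n" and cA: "cmat A \<in> carrier_mat n n"
    and cX: "cmat X \<in> carrier_mat n j"
    using A Q2 X by auto
  \<comment> \<open>The conclusions have \<open>cmat\<close> outermost, as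
    \<open>map_vec_Re_mult\<close> expects, whereas \<open>M_mat\<close> transposes last.\<close>
  have eq: "cmat (transpose_mat Q2) = ?P" "cmat (transpose_mat X) = transpose_mat (cmat X)"
    by (rule eq_matI; simp)+
  have "M_mat A Q2 X l *\<^sub>v (u @\<^sub>v w) =
      (?P * (cmat A - l \<cdot>\<^sub>m 1\<^sub>m n) *\<^sub>v u + (- (?P * cmat X)) *\<^sub>v w) @\<^sub>v
      (transpose_mat (cmat X) *\<^sub>v u + 0\<^sub>m j j *\<^sub>v w)"
    unfolding M_mat_def using A Q2 X u w
    by (subst four_block_mat_mult_vec[of _ q n _ j _ j]) auto
  then have "(?P * (cmat A - l \<cdot>\<^sub>m 1\<^sub>m n) *\<^sub>v u + (- (?P * cmat X)) *\<^sub>v w) @\<^sub>v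
      (transpose_mat (cmat X) *\<^sub>v u + 0\<^sub>m j j *\<^sub>v w) = 0\<^sub>v q @\<^sub>v 0\<^sub>v j"
    using ker by (auto simp: zero_vec_append)
  moreover have "?P * (cmat A - l \<cdot>\<^sub>m 1\<^sub>m n) *\<^sub>v u + (- (?P * cmat X)) *\<^sub>v w \<in> carrier_vec q"
    using P X by (intro add_carrier_vec carrier_vecI) auto
  ultimately have 1: "?P * (cmat A - l \<cdot>\<^sub>m 1\<^sub>m n) *\<^sub>v u + (- (?P * cmat X)) *\<^sub>v w = 0\<^sub>v q"
    and 2: "transpose_mat (cmat X) *\<^sub>v u + 0\<^sub>m j j *\<^sub>v w = 0\<^sub>v j"
    using append_vec_eq[OF _ zero_carrier_vec] by blast+
  have "0\<^sub>m j j *\<^sub>v w = 0\<^sub>v j"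
    using w by (intro eq_vecI) auto
  then show "cmat (transpose_mat X) *\<^sub>v u = 0\<^sub>v j"
    using 2 X u unfolding eq by simp
  have "?P * (cmat A - l \<cdot>\<^sub>m 1\<^sub>m n) *\<^sub>v u = ?P *\<^sub>v ((cmat A - l \<cdot>\<^sub>m 1\<^sub>m n) *\<^sub>v u)"
    using P A u by (intro assoc_mult_mat_vec) auto
  also have "(cmat A - l \<cdot>\<^sub>m 1\<^sub>m n) *\<^sub>v u = cmat A *\<^sub>v u - l \<cdot>\<^sub>v u"
    using cA u by (subst minus_mult_distrib_mat_vec[of _ n n]) (auto intro!: eq_vecI)
  also have "?P *\<^sub>v \<dots> = ?P *\<^sub>v (cmat A *\<^sub>v u) - ?P *\<^sub>v (l \<cdot>\<^sub>v u)"
    using P cA u by (intro mult_minus_distrib_mat_vec) auto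
  finally have 3: "?P * (cmat A - l \<cdot>\<^sub>m 1\<^sub>m n) *\<^sub>v u = \<dots>" .
  have 4: "(- (?P * cmat X)) *\<^sub>v w = - (?P *\<^sub>v (cmat X *\<^sub>v w))"
    using P cX w by (subst uminus_mult_mat_vec) auto
  have "?P *\<^sub>v (cmat A *\<^sub>v u - cmat X *\<^sub>v w - l \<cdot>\<^sub>v u) =
      ?P *\<^sub>v (cmat A *\<^sub>v u) - ?P *\<^sub>v (cmat X *\<^sub>v w) - ?P *\<^sub>v (l \<cdot>\<^sub>v u)"
    using P cA cX u w by (simp add: mult_minus_distrib_mat_vec[of _ q n])
  also have "\<dots> = ?P *\<^sub>v (cmat A *\<^sub>v u) - ?P *\<^sub>v (l \<cdot>\<^sub>v u) + - (?P *\<^sub>v (cmat X *\<^sub>v w))"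
    using P cA cX u w by (intro eq_vecI) auto
  also have "\<dots> = 0\<^sub>v q"
    using 1 unfolding 3 4 .
  finally show "cmat (transpose_mat Q2) *\<^sub>v (cmat A *\<^sub>v u - cmat X *\<^sub>v w - l \<cdot>\<^sub>v u) = 0\<^sub>v q"
    unfolding eq .
qed

section \<open>Rotation of the residual\<close>

text \<open>Both matrices have the shape that represents a complex number as a real 2 by 2 matrix,
  and such matrices commute.\<close>

lemma D0_mat_commute:
  "mat_of_rows_list 2 [[c, s], [- s, c]] * D0_mat \<alpha> \<beta> =
    D0_mat \<alpha> \<beta> * mat_of_rows_list 2 [[c, s], [- s, c]]"
  by (intro eq_matI)
    (auto simp: D0_mat_def mat_of_rows_list_def less_Suc_eq numeral_2_eq_2 scalar_prod_def)

text \<open>Commuting the rotation past \<open>D0_mat\<close> makes it a common right factor, so a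
  vanishing residual stays zero under rotation.\<close>

lemma residual_rotate:
  fixes K A X P W :: "real mat" and c s :: real
  defines "G \<equiv> mat_of_rows_list 2 [[c, s], [- s, c]]"
  assumes K: "K \<in> carrier_mat q n" and A: "A \<in> carrier_mat n n" and X: "X \<in> carrier_mat n j"
    and P: "P \<in> carrier_mat n 2" and W: "W \<in> carrier_mat j 2"
  shows "K * (A * (P * G) - X * (W * G) - P * G * D0_mat \<alpha> \<beta>) =
    K * (A * P - X * W - P * D0_mat \<alpha> \<beta>) * G"
proof -
  have G: "G \<in> carrier_mat 2 2" and D: "D0_mat \<alpha> \<beta> \<in> carrier_mat 2 2"
    by (auto simp: G_def D0_mat_def mat_of_rows_list_def numeral_2_eq_2)
  have "P * G * D0_mat \<alpha> \<beta> = P * D0_mat \<alpha> \<beta> * G"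
    unfolding assoc_mult_mat[OF P G D] assoc_mult_mat[OF P D G] unfolding G_def D0_mat_commute ..
  moreover have "A * (P * G) = A * P * G" "X * (W * G) = X * W * G"
    using A X P W G by (auto simp: assoc_mult_mat)
  ultimately have "A * (P * G) - X * (W * G) - P * G * D0_mat \<alpha> \<beta> =
      (A * P - X * W - P * D0_mat \<alpha> \<beta>) * G"
    using A X P W G D minus_mult_distrib_mat[of "A * P" n 2 "X * W" G 2]
      minus_mult_distrib_mat[of "A * P - X * W" n 2 "P * D0_mat \<alpha> \<beta>" G 2]
    by (simp add: minus_carrier_mat del: assoc_mult_mat)
  also have "K * \<dots> = K * (A * P - X * W - P * D0_mat \<alpha> \<beta>) * G"
    using K A X P W G D by (intro assoc_mult_mat[symmetric]) auto
  finally show ?thesis .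
qed

section \<open>The scalar inequality\<close>

text \<open>Here \<open>p\<close> and \<open>q\<close> are the norms of the rotated vectors
  themselves, not their squares, and \<open>a\<close>, \<open>b\<close> are the squared norms of
  \<open>v1\<close>, \<open>v2\<close>. Each of the three terms is compared with
  \<open>1 / ?m\<close> separately.\<close>

lemma objective_bound:
  fixes p q a b \<beta> :: real
  assumes p: "p > 0" and q: "q > 0" and pq: "p\<^sup>2 + q\<^sup>2 = 1" and "a \<ge> 0" "b \<ge> 0"
  shows "(1 / p)\<^sup>2 * a + (1 / q)\<^sup>2 * b + \<beta>\<^sup>2 * ((1 / p) / (1 / q) - (1 / q) / (1 / p))\<^sup>2
    \<le> 1 / min (p\<^sup>2) (q\<^sup>2) * (a + b + \<beta>\<^sup>2)"
proof -
  let ?m = "min (p\<^sup>2) (q\<^sup>2)"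
  have m: "?m > 0" using p q by simp
  have 1: "(1 / p)\<^sup>2 * a \<le> 1 / ?m * a" "(1 / q)\<^sup>2 * b \<le> 1 / ?m * b"
    using assms m by (auto intro!: mult_right_mono divide_left_mono simp: power_divide)
  \<comment> \<open>One factor \<bar>x - y\<bar> is at most \<open>max x y\<close>, the other at
    most \<open>x + y = 1\<close>; then \<open>x * y\<close> is the product of maximum and
    minimum.\<close>
  have *: "(x - y)\<^sup>2 / (x * y) \<le> 1 / min x y" if "x > 0" "y > 0" "x + y = 1" for x y :: real
  proof -
    have "(x - y)\<^sup>2 = \<bar>x - y\<bar> * \<bar>x - y\<bar>" by (simp add: power2_eq_square)
    also have "\<dots> \<le> max x y * 1"
      using that by (intro mult_mono) (auto simp: abs_if max_def)
    finally have "(x - y)\<^sup>2 / (x * y) \<le> max x y / (x * y)"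
      using that by (intro divide_right_mono) auto
    also have "\<dots> = 1 / min x y"
      using that by (auto simp: min_def max_def)
    finally show ?thesis .
  qed
  have "((1 / p) / (1 / q) - (1 / q) / (1 / p))\<^sup>2 = (p\<^sup>2 - q\<^sup>2)\<^sup>2 / (p\<^sup>2 * q\<^sup>2)"
    using p q by (simp add: field_simps power2_eq_square)
  also have "\<dots> \<le> 1 / ?m"
    using p q pq by (intro *) auto
  finally have "\<beta>\<^sup>2 * ((1 / p) / (1 / q) - (1 / q) / (1 / p))\<^sup>2 \<le> \<beta>\<^sup>2 * (1 / ?m)"
    by (intro mult_left_mono) auto
  with 1 show ?thesis
    by (simp add: algebra_simps add_divide_distrib)
qed

section \<open>The constraints and the bound for the rotated vectors\<close>

theorem theorem3p1:
  fixes n m j r :: nat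
    and A B Q Q1 Q2 R X T Sig :: "real mat"
    and S S1 S2 U V :: "complex mat"
    and \<alpha> \<beta> \<sigma>1 c s \<delta>1 \<delta>2 :: real
    and u1 w :: "complex vec"
    and x1 x2 v1 v2 :: "real vec"
  assumes A: "A \<in> carrier_mat n n"
    and B: "B \<in> carrier_mat n m" "vec_space.rank n B = m"
    and ctrb: "controllable n m A B"
    and Q: "orthogonal_matrix n Q" "Q = Q1 @\<^sub>c Q2"
      "Q1 \<in> carrier_mat n m" "Q2 \<in> carrier_mat n (n - m)"
    and R: "R \<in> carrier_mat m m" "upper_triangular R" "invertible_mat R"
    and QR: "B = Q * (R @\<^sub>r 0\<^sub>m (n - m) m)"
    and j: "1 \<le> j" "j \<le> n - 2"
    and X: "X \<in> carrier_mat n j" "transpose_mat X * X = 1\<^sub>m j"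
    and T: "upper_quasi_triangular j T"
    and XT: "transpose_mat Q2 * (A * X - X * T) = 0\<^sub>m (n - m) j"
    and \<beta>: "\<beta> \<noteq> 0"
    and r: "r = kernel_dim (M_mat A Q2 X (Complex \<alpha> \<beta>))"
    and S: "orthonormal_basis_of_kernel (M_mat A Q2 X (Complex \<alpha> \<beta>)) r S"
      "S = S1 @\<^sub>r S2" "S1 \<in> carrier_mat n r" "S2 \<in> carrier_mat j r"
    and svd: "is_svd n r S1 U Sig V"
    and \<sigma>1: "\<sigma>1 = Sig $$ (0, 0)" "\<sigma>1 > 0"
    and u1: "u1 = U *\<^sub>v unit_vec n 0"
    and indep: "lin_indpt_pair n (Re_vec u1) (Im_vec u1)"
    and w: "w = (1 / complex_of_real \<sigma>1) \<cdot>\<^sub>v (S2 *\<^sub>v (V *\<^sub>v unit_vec r 0))"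
    and cs: "c = jacobi_c u1" "s = jacobi_s u1"
    and x: "x1 \<in> carrier_vec n" "x2 \<in> carrier_vec n"
      "mat_of_cols n [x1, x2] =
        mat_of_cols n [Re_vec u1, Im_vec u1] * mat_of_rows_list 2 [[c, s], [- s, c]]"
    and v: "v1 \<in> carrier_vec j" "v2 \<in> carrier_vec j"
      "mat_of_cols j [v1, v2] =
        mat_of_cols j [Re_vec w, Im_vec w] * mat_of_rows_list 2 [[c, s], [- s, c]]"
    and \<delta>: "\<delta>1 = 1 / norm2 x1" "\<delta>2 = 1 / norm2 x2"
  shows "transpose_mat Q2 *
        (A * mat_of_cols n [x1, x2] - X * mat_of_cols j [v1, v2]
          - mat_of_cols n [x1, x2] * D0_mat \<alpha> \<beta>) = 0\<^sub>m (n - m) 2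
    \<and> transpose_mat X * mat_of_cols n [x1, x2] = 0\<^sub>m j 2
    \<and> transpose_mat (mat_of_cols n [x1, x2]) * mat_of_cols n [x1, x2] =
        mat_of_rows_list 2 [[1 / \<delta>1\<^sup>2, 0], [0, 1 / \<delta>2\<^sup>2]]
    \<and> (norm2 (\<delta>1 \<cdot>\<^sub>v v1))\<^sup>2 + (norm2 (\<delta>2 \<cdot>\<^sub>v v2))\<^sup>2 + \<beta>\<^sup>2 * (\<delta>1 / \<delta>2 - \<delta>2 / \<delta>1)\<^sup>2
        \<le> 1 / min ((norm2 x1)\<^sup>2) ((norm2 x2)\<^sup>2) * ((1 - \<sigma>1\<^sup>2) / \<sigma>1\<^sup>2 + \<beta>\<^sup>2)"
proof -
  let ?M = "M_mat A Q2 X (Complex \<alpha> \<beta>)"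
  let ?G = "mat_of_rows_list 2 [[c, s], [- s, c]]"
  have G: "?G \<in> carrier_mat 2 2" by (simp add: mat_of_rows_list_def numeral_2_eq_2)
  have n0: "n > 0" using j by simp
  \<comment> \<open>For \<open>r = 0\<close> the entry \<open>Sig $$ (0, 0)\<close> would be a junk value. Controllability rules this
    out: it forces \<open>m > 0\<close>, so \<open>M\<close> has more columns than rows.\<close>
  have "m > 0"
  proof (rule ccontr)
    assume "\<not> m > 0"
    then have "controllability_matrix n m A B \<in> carrier_mat n 0"
      by (simp add: controllability_matrix_def)
    then have "vec_space.rank n (controllability_matrix n m A B) \<le> 0"
      by (rule vec_space.rank_le_nc)
    then show False
      using ctrb n0 by (simp add: controllable_def)
  qed
  have M: "?M \<in> carrier_mat (n - m + j) (n + j)"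
    using A Q X by (auto simp: M_mat_def)
  \<comment> \<open>Subtraction on \<open>nat\<close> is truncated, so \<open>n - m < n\<close>
    rests on \<open>n > 0\<close> as well as \<open>m > 0\<close>.\<close>
  then have "dim_row ?M < dim_col ?M"
    using n0 \<open>m > 0\<close> by auto
  then have r0: "r > 0"
    using orthonormal_basis_of_kernel_wide[OF S(1)] by blast

  \<comment> \<open>The kernel vector from the leading singular pair\<close>
  have U: "unitary_matrix n U" and V: "unitary_matrix r V"
    using svd by (auto simp: is_svd_def)
  define p where "p = V *\<^sub>v unit_vec r 0"
  have p: "p \<in> carrier_vec r" and pp: "p \<bullet>c p = 1"
    using V unitary_matrix_unit_vec[OF V r0] by (auto simp: p_def unitary_matrix_def)
  have u: "u1 \<in> carrier_vec n" and uu: "u1 \<bullet>c u1 = 1"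
    using U unitary_matrix_unit_vec[OF U n0] by (auto simp: u1 unitary_matrix_def)
  have wc: "w \<in> carrier_vec j"
    using S p by (simp add: w p_def[symmetric])
  have S1p: "S1 *\<^sub>v p = complex_of_real \<sigma>1 \<cdot>\<^sub>v u1"
    using is_svd_singular_vector[OF svd n0 r0] by (simp add: p_def u1 \<sigma>1)
  have S2p: "S2 *\<^sub>v p = complex_of_real \<sigma>1 \<cdot>\<^sub>v w"
    using \<sigma>1(2) S(4) p by (simp add: w p_def[symmetric] smult_smult_assoc)
  \<comment> \<open>The division by \<sigma>1 in \<open>w\<close> gives both blocks the same factor,
    so \<open>S *\<^sub>v p\<close> is a multiple of the stacked vector.\<close>
  have Sp: "S *\<^sub>v p = complex_of_real \<sigma>1 \<cdot>\<^sub>v (u1 @\<^sub>v w)"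
  proof -
    have "S *\<^sub>v p = S1 *\<^sub>v p @\<^sub>v S2 *\<^sub>v p"
      unfolding S(2) using S(3,4) p by (rule mat_mult_append)
    also have "\<dots> = complex_of_real \<sigma>1 \<cdot>\<^sub>v (u1 @\<^sub>v w)"
      unfolding S1p S2p by (intro eq_vecI) auto
    finally show ?thesis .
  qed
  have uw: "u1 @\<^sub>v w \<in> carrier_vec (n + j)" using u wc by simp
  have "complex_of_real \<sigma>1 \<cdot>\<^sub>v (?M *\<^sub>v (u1 @\<^sub>v w)) = 0\<^sub>v (n - m + j)"
    using orthonormal_basis_of_kernel_mult[OF S(1) p] M mult_mat_vec[OF M uw] by (simp add: Sp)
  \<comment> \<open>Since \<sigma>1 is positive, the factor cancels.\<close>
  then have "complex_of_real (1 / \<sigma>1) \<cdot>\<^sub>v (complex_of_real \<sigma>1 \<cdot>\<^sub>v (?M *\<^sub>v (u1 @\<^sub>v w)))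
      = complex_of_real (1 / \<sigma>1) \<cdot>\<^sub>v 0\<^sub>v (n - m + j)" by (rule arg_cong)
  then have "?M *\<^sub>v (u1 @\<^sub>v w) = 0\<^sub>v (n - m + j)"
    using \<sigma>1(2) by (simp add: smult_smult_assoc smult_zero_vec)
  note ker = M_mat_kernel[OF A Q(4) X(1) u wc this]

  \<comment> \<open>The linear constraints in real form\<close>
  define a b wa wb where ab: "a = Re_vec u1" "b = Im_vec u1" "wa = Re_vec w" "wb = Im_vec w"
  have a: "a \<in> carrier_vec n" and b: "b \<in> carrier_vec n"
    and wa: "wa \<in> carrier_vec j" and wb: "wb \<in> carrier_vec j"
    using u wc by (auto simp: ab)
  have Q2T: "transpose_mat Q2 \<in> carrier_mat (n - m) n" and XT': "transpose_mat X \<in> carrier_mat j n"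
    using Q X by auto
  \<comment> \<open>The complex residual. Its real and imaginary parts are the two columns of the
    real residual, because those of \<open>Complex \<alpha> \<beta> \<cdot>\<^sub>v u1\<close> are
    the columns of \<open>?P * D0_mat \<alpha> \<beta>\<close>.\<close>
  let ?z = "cmat A *\<^sub>v u1 - cmat X *\<^sub>v w - Complex \<alpha> \<beta> \<cdot>\<^sub>v u1"
  have z: "?z \<in> carrier_vec n" using A X u wc by auto
  have Rez: "Re_vec ?z = A *\<^sub>v a - X *\<^sub>v wa - (\<alpha> \<cdot>\<^sub>v a + (- \<beta>) \<cdot>\<^sub>v b)"
    using A X u wc
    unfolding ab map_vec_Re_mult[OF A u, symmetric] map_vec_Re_mult[OF X(1) wc, symmetric]
    by (intro eq_vecI) auto
  have Imz: "Im_vec ?z = A *\<^sub>v b - X *\<^sub>v wb - (\<beta> \<cdot>\<^sub>v a + \<alpha> \<cdot>\<^sub>v b)"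
    using A X u wc
    unfolding ab map_vec_Im_mult[OF A u, symmetric] map_vec_Im_mult[OF X(1) wc, symmetric]
    by (intro eq_vecI) (auto simp: algebra_simps)
  have zero: "Re_vec (0\<^sub>v k) = 0\<^sub>v k" "Im_vec (0\<^sub>v k) = 0\<^sub>v k" for k
    by (auto intro: eq_vecI)
  have z0: "mat_of_cols k [0\<^sub>v k, 0\<^sub>v k] = (0\<^sub>m k 2 :: real mat)" for k
    by (intro eq_matI) (auto simp: mat_of_cols_index less_Suc_eq numeral_2_eq_2)
  let ?P = "mat_of_cols n [a, b]" and ?W = "mat_of_cols j [wa, wb]"
  have P: "?P \<in> carrier_mat n 2" and W: "?W \<in> carrier_mat j 2" by auto
  have PD: "?P * D0_mat \<alpha> \<beta> = mat_of_cols n [\<alpha> \<cdot>\<^sub>v a + (- \<beta>) \<cdot>\<^sub>v b, \<beta> \<cdot>\<^sub>v a + \<alpha> \<cdot>\<^sub>v b]"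
    unfolding D0_mat_def by (rule mat_of_cols_pair_mult[OF a b])
  have "A * ?P - X * ?W - ?P * D0_mat \<alpha> \<beta> = mat_of_cols n [Re_vec ?z, Im_vec ?z]"
    unfolding PD mult_mat_of_cols_pair[OF A a b] mult_mat_of_cols_pair[OF X(1) wa wb] Rez Imz
    using A X(1) a b wa wb by (simp add: minus_mat_of_cols_pair)
  then have "transpose_mat Q2 * (A * ?P - X * ?W - ?P * D0_mat \<alpha> \<beta>) =
      mat_of_cols (n - m) [transpose_mat Q2 *\<^sub>v Re_vec ?z, transpose_mat Q2 *\<^sub>v Im_vec ?z]"
    using mult_mat_of_cols_pair[OF Q2T, of "Re_vec ?z" "Im_vec ?z"] z by simp
  also have "\<dots> = 0\<^sub>m (n - m) 2"
    unfolding map_vec_Re_mult[OF Q2T z, symmetric] map_vec_Im_mult[OF Q2T z, symmetric] ker zero z0 ..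
  finally have res0: "transpose_mat Q2 * (A * ?P - X * ?W - ?P * D0_mat \<alpha> \<beta>) = 0\<^sub>m (n - m) 2" .
  have xG: "mat_of_cols n [x1, x2] = ?P * ?G" and vG: "mat_of_cols j [v1, v2] = ?W * ?G"
    using x(3) v(3) by (simp_all add: ab)
  have c1: "transpose_mat Q2 * (A * mat_of_cols n [x1, x2] - X * mat_of_cols j [v1, v2]
          - mat_of_cols n [x1, x2] * D0_mat \<alpha> \<beta>) = 0\<^sub>m (n - m) 2"
    unfolding xG vG residual_rotate[OF Q2T A X(1) P W] res0 using G by (rule left_mult_zero_mat)
  have "transpose_mat X * ?P = 0\<^sub>m j 2"
    unfolding mult_mat_of_cols_pair[OF XT' a b] unfolding ab
      map_vec_Re_mult[OF XT' u, symmetric] map_vec_Im_mult[OF XT' u, symmetric] ker zero z0 ..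
  then have c2: "transpose_mat X * mat_of_cols n [x1, x2] = 0\<^sub>m j 2"
    unfolding xG assoc_mult_mat[OF XT' P G, symmetric] using left_mult_zero_mat[OF G] by simp

  \<comment> \<open>Orthogonality, norms and the objective\<close>
  have "x1 = c \<cdot>\<^sub>v a + (- s) \<cdot>\<^sub>v b \<and> x2 = s \<cdot>\<^sub>v a + c \<cdot>\<^sub>v b"
    using xG unfolding mat_of_cols_pair_mult[OF a b]
    by (rule mat_of_cols_pair_inj) (use x a b in auto)
  then have x1: "x1 = c \<cdot>\<^sub>v a + (- s) \<cdot>\<^sub>v b" and x2: "x2 = s \<cdot>\<^sub>v a + c \<cdot>\<^sub>v b" by auto
  have "v1 = c \<cdot>\<^sub>v wa + (- s) \<cdot>\<^sub>v wb \<and> v2 = s \<cdot>\<^sub>v wa + c \<cdot>\<^sub>v wb"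
    using vG unfolding mat_of_cols_pair_mult[OF wa wb]
    by (rule mat_of_cols_pair_inj) (use v wa wb in auto)
  then have v1: "v1 = c \<cdot>\<^sub>v wa + (- s) \<cdot>\<^sub>v wb" and v2: "v2 = s \<cdot>\<^sub>v wa + c \<cdot>\<^sub>v wb" by auto
  have cs1: "c\<^sup>2 + s\<^sup>2 = 1" using jacobi_norm by (simp add: cs)
  have x12: "x1 \<bullet> x2 = 0"
    using jacobi_orthogonal[of u1] unfolding x1 x2 scalar_prod_lin_comb2[OF a b]
    by (simp add: cs ab power2_eq_square algebra_simps)
  \<comment> \<open>Kept general because it serves the pair \<open>a\<close>, \<open>b\<close> in
    dimension \<open>n\<close> and the pair \<open>wa\<close>, \<open>wb\<close> in dimension
    \<open>j\<close>.\<close>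
  have norm_sum: "(c \<cdot>\<^sub>v y + (- s) \<cdot>\<^sub>v y') \<bullet> (c \<cdot>\<^sub>v y + (- s) \<cdot>\<^sub>v y')
      + (s \<cdot>\<^sub>v y + c \<cdot>\<^sub>v y') \<bullet> (s \<cdot>\<^sub>v y + c \<cdot>\<^sub>v y') = y \<bullet> y + y' \<bullet> y'"
    if "y \<in> carrier_vec k" "y' \<in> carrier_vec k" for y y' :: "real vec" and k
  proof -
    have "(c \<cdot>\<^sub>v y + (- s) \<cdot>\<^sub>v y') \<bullet> (c \<cdot>\<^sub>v y + (- s) \<cdot>\<^sub>v y')
      + (s \<cdot>\<^sub>v y + c \<cdot>\<^sub>v y') \<bullet> (s \<cdot>\<^sub>v y + c \<cdot>\<^sub>v y') = (c\<^sup>2 + s\<^sup>2) * (y \<bullet> y + y' \<bullet> y')"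
      unfolding scalar_prod_lin_comb2[OF that] by (simp add: power2_eq_square algebra_simps)
    then show ?thesis by (simp add: cs1)
  qed
  have "complex_of_real (a \<bullet> a + b \<bullet> b) = 1"
    using uu unfolding cscalar_prod_self_Re_Im ab .
  then have xx: "(norm2 x1)\<^sup>2 + (norm2 x2)\<^sup>2 = 1"
    using norm_sum[OF a b] unfolding norm2_square x1 x2 by (metis of_real_eq_1_iff)
  \<comment> \<open>The unit vector \<open>p\<close> keeps its length under \<open>S\<close>, so 1
    is \<open>\<sigma>1\<^sup>2\<close> times the squared length of the stacked vector, to which
    \<open>u1\<close> contributes 1.\<close>
  have ww: "wa \<bullet> wa + wb \<bullet> wb = (1 - \<sigma>1\<^sup>2) / \<sigma>1\<^sup>2"
  proof -
    have SS: "S \<in> carrier_mat (n + j) r" "mat_adjoint S * S = 1\<^sub>m r"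
      using S(1) M by (auto simp: orthonormal_basis_of_kernel_def)
    have "1 = (S *\<^sub>v p) \<bullet>c (S *\<^sub>v p)"
      using cscalar_prod_isometry[OF SS p] pp by simp
    also have "\<dots> = complex_of_real (\<sigma>1\<^sup>2) * ((u1 @\<^sub>v w) \<bullet>c (u1 @\<^sub>v w))"
      unfolding Sp using uw by (simp add: conjugate_smult_vec power2_eq_square)
    also have "conjugate (u1 @\<^sub>v w) = conjugate u1 @\<^sub>v conjugate w"
      by (intro eq_vecI) auto
    also have "(u1 @\<^sub>v w) \<bullet> \<dots> = u1 \<bullet>c u1 + w \<bullet>c w"
      using u wc by (intro scalar_prod_append) auto
    also have "\<dots> = complex_of_real (1 + (wa \<bullet> wa + wb \<bullet> wb))"
      unfolding uu by (simp add: cscalar_prod_self_Re_Im[of w] ab)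
    finally have "complex_of_real 1 = complex_of_real (\<sigma>1\<^sup>2 * (1 + (wa \<bullet> wa + wb \<bullet> wb)))"
      by simp
    then have "1 = \<sigma>1\<^sup>2 * (1 + (wa \<bullet> wa + wb \<bullet> wb))"
      by (simp only: of_real_eq_iff)
    then show ?thesis
      using \<sigma>1(2) by (simp add: field_simps)
  qed
  have vv: "(norm2 v1)\<^sup>2 + (norm2 v2)\<^sup>2 = (1 - \<sigma>1\<^sup>2) / \<sigma>1\<^sup>2"
    using norm_sum[OF wa wb] ww unfolding norm2_square v1 v2 by simp
  \<comment> \<open>Independence excludes the zero vector. It applies to both rotated vectors
    because \<open>c\<^sup>2 + s\<^sup>2 = 1\<close> forbids \<open>c = s = 0\<close>.\<close>
  have pos: "norm2 y > 0" if "y = k \<cdot>\<^sub>v a + l \<cdot>\<^sub>v b" "(k, l) \<noteq> (0, 0)" for y k l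
  proof -
    have "y \<noteq> 0\<^sub>v n"
      using indep that unfolding lin_indpt_pair_def ab by auto
    moreover have "y \<in> carrier_vec n" using that a b by simp
    ultimately have "y \<bullet> y > 0"
      using conjugate_square_greater_0_vec[of y n] by (simp add: conjugate_vec_def)
    then show ?thesis by (simp add: norm2_def)
  qed
  have pos1: "norm2 x1 > 0" and pos2: "norm2 x2 > 0"
    using pos[OF x1] pos[OF x2] cs1 by fastforce+
  have c3: "transpose_mat (mat_of_cols n [x1, x2]) * mat_of_cols n [x1, x2] =
        mat_of_rows_list 2 [[1 / \<delta>1\<^sup>2, 0], [0, 1 / \<delta>2\<^sup>2]]"
    unfolding gram_mat_of_cols_pair[OF x(1,2)] x12 \<delta> norm2_square[symmetric]
    by (simp add: power_divide)
  \<comment> \<open>Reading \<open>vv\<close> backwards turns the term in \<sigma>1 into the sum of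
    the squared norms of \<open>v1\<close> and \<open>v2\<close>, the \<open>a + b\<close> of
    \<open>objective_bound\<close>.\<close>
  have c4: "(norm2 (\<delta>1 \<cdot>\<^sub>v v1))\<^sup>2 + (norm2 (\<delta>2 \<cdot>\<^sub>v v2))\<^sup>2 + \<beta>\<^sup>2 * (\<delta>1 / \<delta>2 - \<delta>2 / \<delta>1)\<^sup>2
        \<le> 1 / min ((norm2 x1)\<^sup>2) ((norm2 x2)\<^sup>2) * ((1 - \<sigma>1\<^sup>2) / \<sigma>1\<^sup>2 + \<beta>\<^sup>2)"
    unfolding norm2_smult \<delta> vv[symmetric]
    by (rule objective_bound[OF pos1 pos2 xx]) auto
  show ?thesis using c1 c2 c3 c4 by blast
qed

end
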